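(* For any nontrivial matroid $M$, \[ \mu_f(H_B(M)) = \tau_f(H_B(M)) = \sigma'(M). \]
   Context: Let $M$ be a matroid on a finite ground set $V$ with set of bases $B(M)$ and rank function $\rho_M(S) = \max\{|S\cap e| : e\in B(M)\}$. $H_B(M)$ is the hypergraph with vertex set $V$ and edge set $B(M)$. For a hypergraph $H=(V,E)$: $\mu_f(H)$ is the optimal value of $\max\sum_e y_e$ s.t. $\sum_{e\ni v}y_e\le 1$ for all $v\in V$, $y\ge 0$; $\tau_f(H)$ is the optimal value of $\min\sum_v x_v$ s.t. $\sum_{v\in e}x_v\ge 1$ for all $e\in E$, $x\ge 0$. The edge toughness of $M$ is $\sigma'(M) = \min_{S\subseteq V,\ \rho_M(V)>\rho_M(S)} \frac{|V\setminus S|}{\rho_M(V)-\rho_M(S)}$. $M$ is nontrivial if $\rho_M(V) > 0$ and $M$ has no coloop (an element belonging to every basis). *)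

theory Defs
  imports "HOL-Analysis.Analysis"
begin

text \<open>A matroid is given by its ground set \<open>V\<close> and its set of bases \<open>\<B>\<close>.\<close>

locale matroid =
  fixes V :: "'a set" and \<B> :: "'a set set"
  assumes finite_ground: "finite V"
    and bases_subset: "b \<in> \<B> \<Longrightarrow> b \<subseteq> V"
    and bases_nonempty: "\<B> \<noteq> {}"
    and basis_exchange: "\<lbrakk>b \<in> \<B>; c \<in> \<B>; u \<in> b - c\<rbrakk> \<Longrightarrow> \<exists>w \<in> c - b. insert w (b - {u}) \<in> \<B>"

definition matroid_rank :: "'a set set \<Rightarrow> 'a set \<Rightarrow> nat" where
  "matroid_rank \<B> S = Max {card (S \<inter> e) | e. e \<in> \<B>}"

definition coloop :: "'a set \<Rightarrow> 'a set set \<Rightarrow> 'a \<Rightarrow> bool" where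
  "coloop V \<B> v \<longleftrightarrow> v \<in> V \<and> (\<forall>b \<in> \<B>. v \<in> b)"

definition nontrivial_matroid :: "'a set \<Rightarrow> 'a set set \<Rightarrow> bool" where
  "nontrivial_matroid V \<B> \<longleftrightarrow>
     matroid V \<B> \<and> matroid_rank \<B> V > 0 \<and> \<not> (\<exists>v. coloop V \<B> v)"

definition edge_toughness :: "'a set \<Rightarrow> 'a set set \<Rightarrow> real" where
  "edge_toughness V \<B> =
     Min {real (card (V - S)) / (real (matroid_rank \<B> V) - real (matroid_rank \<B> S)) | S.
            S \<subseteq> V \<and> matroid_rank \<B> V > matroid_rank \<B> S}"

type_synonym 'a hypergraph = "'a set \<times> 'a set set"

definition basis_hypergraph :: "'a set \<Rightarrow> 'a set set \<Rightarrow> 'a hypergraph" where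
  "basis_hypergraph V \<B> = (V, \<B>)"

definition fractional_matching :: "'a hypergraph \<Rightarrow> ('a set \<Rightarrow> real) \<Rightarrow> bool" where
  "fractional_matching H y \<longleftrightarrow> (case H of (V, E) \<Rightarrow>
     (\<forall>e \<in> E. y e \<ge> 0) \<and> (\<forall>v \<in> V. (\<Sum>e \<in> {e \<in> E. v \<in> e}. y e) \<le> 1))"

definition fractional_cover :: "'a hypergraph \<Rightarrow> ('a \<Rightarrow> real) \<Rightarrow> bool" where
  "fractional_cover H x \<longleftrightarrow> (case H of (V, E) \<Rightarrow>
     (\<forall>v \<in> V. x v \<ge> 0) \<and> (\<forall>e \<in> E. (\<Sum>v \<in> e. x v) \<ge> 1))"

text \<open>
  The optimal values are a supremum and an infimum of reals. On finite hypergraphs with nonempty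
  edges both are attained; see \<open>fractional_matching_number_attained\<close> and
  \<open>fractional_cover_number_attained\<close> below.
\<close>

definition fractional_matching_number :: "'a hypergraph \<Rightarrow> real" where
  "fractional_matching_number H = Sup {(\<Sum>e \<in> snd H. y e) | y. fractional_matching H y}"

definition fractional_cover_number :: "'a hypergraph \<Rightarrow> real" where
  "fractional_cover_number H = Inf {(\<Sum>v \<in> fst H. x v) | x. fractional_cover H x}"

definition unit_cube :: "'i set \<Rightarrow> ('i \<Rightarrow> real) set" where
  "unit_cube I = {f. \<forall>i. f i \<in> (if i \<in> I then {0..1} else {0})}"

lemma compact_unit_cube: "compact (unit_cube I)"
proof -
  have "unit_cube I = PiE UNIV (\<lambda>i. if i \<in> I then {0..1} else {0})"
    by (auto simp: unit_cube_def PiE_def Pi_def)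
  moreover have "compactin (product_topology (\<lambda>i. euclidean) UNIV)
      (PiE UNIV (\<lambda>i. if i \<in> I then {0..1::real} else {0}))"
    by (subst compactin_PiE) auto
  ultimately show ?thesis
    by (simp add: euclidean_product_topology)
qed

lemma continuous_on_sum_coordinates:
  "continuous_on UNIV (\<lambda>f :: 'i \<Rightarrow> real. \<Sum>i \<in> J. f i)"
  by (intro continuous_on_sum continuous_on_product_coordinates)

lemma closed_fractional_matching: "closed {y. fractional_matching (V, E) y}"
proof -
  have eq: "{y. fractional_matching (V, E) y} =
      (\<Inter>e \<in> E. {y. 0 \<le> y e}) \<inter> (\<Inter>v \<in> V. {y. (\<Sum>e \<in> {e \<in> E. v \<in> e}. y e) \<le> 1})"
    by (auto simp: fractional_matching_def)
  show ?thesis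
    unfolding eq
    by (intro closed_Int closed_INT ballI closed_Collect_le continuous_on_const
        continuous_on_product_coordinates continuous_on_sum_coordinates)
qed

lemma closed_fractional_cover: "closed {x. fractional_cover (V, E) x}"
proof -
  have eq: "{x. fractional_cover (V, E) x} =
      (\<Inter>v \<in> V. {x. 0 \<le> x v}) \<inter> (\<Inter>e \<in> E. {x. 1 \<le> (\<Sum>v \<in> e. x v)})"
    by (auto simp: fractional_cover_def)
  show ?thesis
    unfolding eq
    by (intro closed_Int closed_INT ballI closed_Collect_le continuous_on_const
        continuous_on_product_coordinates continuous_on_sum_coordinates)
qed

lemma fractional_matching_number_attained:
  assumes "finite V" and sub: "\<And>e. e \<in> E \<Longrightarrow> e \<subseteq> V" and ne: "\<And>e. e \<in> E \<Longrightarrow> e \<noteq> {}"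
  shows "\<exists>y. fractional_matching (V, E) y \<and> (\<Sum>e \<in> E. y e) = fractional_matching_number (V, E) \<and>
    (\<forall>z. fractional_matching (V, E) z \<longrightarrow> (\<Sum>e \<in> E. z e) \<le> (\<Sum>e \<in> E. y e))"
proof -
  have "E \<subseteq> Pow V" using sub by blast
  then have finE: "finite E" using \<open>finite V\<close> by (meson finite_Pow_iff finite_subset)
  define F where "F = unit_cube E \<inter> {y. fractional_matching (V, E) y}"
  have "compact F"
    unfolding F_def by (intro compact_Int_closed compact_unit_cube closed_fractional_matching)
  moreover have "(\<lambda>_. 0) \<in> F"
    by (auto simp: F_def unit_cube_def fractional_matching_def)
  ultimately obtain y where y: "y \<in> F" and ymax: "\<And>z. z \<in> F \<Longrightarrow> (\<Sum>e \<in> E. z e) \<le> (\<Sum>e \<in> E. y e)"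
    using continuous_attains_sup[of F "\<lambda>z. \<Sum>e \<in> E. z e"]
      continuous_on_subset[OF continuous_on_sum_coordinates] by blast
  have max: "(\<Sum>e \<in> E. z e) \<le> (\<Sum>e \<in> E. y e)" if z: "fractional_matching (V, E) z" for z
  proof -
    define z' where "z' e = (if e \<in> E then z e else 0)" for e
    have sums: "(\<Sum>e \<in> {e \<in> E. v \<in> e}. z' e) = (\<Sum>e \<in> {e \<in> E. v \<in> e}. z e)" for v
      by (intro sum.cong) (auto simp: z'_def)
    have "z e \<le> 1" if e: "e \<in> E" for e
    proof -
      obtain v where v: "v \<in> e" using ne[OF e] by blast
      have "z e \<le> (\<Sum>e \<in> {e \<in> E. v \<in> e}. z e)"
        using z e v finE by (intro member_le_sum) (auto simp: fractional_matching_def)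
      also have "\<dots> \<le> 1"
        using z v sub[OF e] by (auto simp: fractional_matching_def)
      finally show ?thesis .
    qed
    then have "z' \<in> F"
      using z by (auto simp: F_def unit_cube_def fractional_matching_def sums) (auto simp: z'_def)
    from ymax[OF this] show ?thesis by (simp add: z'_def)
  qed
  moreover have fy: "fractional_matching (V, E) y" using y by (simp add: F_def)
  moreover have "fractional_matching_number (V, E) = (\<Sum>e \<in> E. y e)"
    unfolding fractional_matching_number_def
    by (rule cSup_eq_maximum) (use fy max in auto)
  ultimately show ?thesis by auto
qed

lemma fractional_cover_number_attained:
  assumes finV: "finite V" and sub: "\<And>e. e \<in> E \<Longrightarrow> e \<subseteq> V" and ne: "\<And>e. e \<in> E \<Longrightarrow> e \<noteq> {}"
  shows "\<exists>x. fractional_cover (V, E) x \<and> (\<Sum>v \<in> V. x v) = fractional_cover_number (V, E) \<and>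
    (\<forall>z. fractional_cover (V, E) z \<longrightarrow> (\<Sum>v \<in> V. x v) \<le> (\<Sum>v \<in> V. z v))"
proof -
  define F where "F = unit_cube V \<inter> {x. fractional_cover (V, E) x}"
  have truncate: "(\<lambda>v. if v \<in> V then min (z v) 1 else 0) \<in> F" (is "?t \<in> F")
    if z: "fractional_cover (V, E) z" for z
  proof -
    have "1 \<le> (\<Sum>v \<in> e. ?t v)" if e: "e \<in> E" for e
    proof (cases "\<exists>u \<in> e. 1 \<le> z u")
      case True
      then obtain u where u: "u \<in> e" "1 \<le> z u" by blast
      have "?t u \<le> (\<Sum>v \<in> e. ?t v)"
        using z u sub[OF e] finV by (intro member_le_sum) (auto simp: fractional_cover_def intro: finite_subset)
      then show ?thesis using u sub[OF e] by (auto simp: min_def split: if_splits)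
    next
      case False
      then have "(\<Sum>v \<in> e. ?t v) = (\<Sum>v \<in> e. z v)"
        using sub[OF e] by (intro sum.cong) (auto simp: min_def)
      then show ?thesis using z e by (simp add: fractional_cover_def)
    qed
    then show ?thesis using z by (auto simp: F_def unit_cube_def fractional_cover_def)
  qed
  have "1 \<le> card e" if "e \<in> E" for e
    using ne[OF that] finite_subset[OF sub[OF that] finV] by (simp add: Suc_le_eq card_gt_0_iff)
  then have "fractional_cover (V, E) (\<lambda>_. 1)"
    by (auto simp: fractional_cover_def)
  from truncate[OF this] have "F \<noteq> {}" by blast
  moreover have "compact F"
    unfolding F_def by (intro compact_Int_closed compact_unit_cube closed_fractional_cover)
  ultimately obtain x where x: "x \<in> F" and xmin: "\<And>z. z \<in> F \<Longrightarrow> (\<Sum>v \<in> V. x v) \<le> (\<Sum>v \<in> V. z v)"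
    using continuous_attains_inf[of F "\<lambda>z. \<Sum>v \<in> V. z v"]
      continuous_on_subset[OF continuous_on_sum_coordinates] by blast
  have min: "(\<Sum>v \<in> V. x v) \<le> (\<Sum>v \<in> V. z v)" if z: "fractional_cover (V, E) z" for z
  proof -
    have "(\<Sum>v \<in> V. x v) \<le> (\<Sum>v \<in> V. if v \<in> V then min (z v) 1 else 0)"
      by (rule xmin[OF truncate[OF z]])
    also have "\<dots> \<le> (\<Sum>v \<in> V. z v)" by (intro sum_mono) auto
    finally show ?thesis .
  qed
  moreover have fx: "fractional_cover (V, E) x" using x by (simp add: F_def)
  moreover have "fractional_cover_number (V, E) = (\<Sum>v \<in> V. x v)"
    unfolding fractional_cover_number_def
    by (rule cInf_eq_minimum) (use fx min in auto)
  ultimately show ?thesis by auto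
qed

end

theory Submission
  imports Defs
begin

text \<open>
  Weak duality gives \<open>\<mu>\<^sub>f \<le> \<tau>\<^sub>f\<close>, and for each \<open>S\<close> of deficient rank the indicator function of \<open>V - S\<close>,
  divided by \<open>\<rho>(V) - \<rho>(S)\<close>, is a fractional cover, so \<open>\<tau>\<^sub>f \<le> \<sigma>'\<close>. For \<open>\<sigma>' \<le> \<mu>\<^sub>f\<close>, let \<open>p\<close> be the point
  of least Euclidean norm in the base polytope, a convex combination of bases with coefficients \<open>y\<close>,
  and let \<open>T\<close> be the set where \<open>p\<close> attains its maximum \<open>m\<close>. A basis \<open>b\<close> in the support of \<open>y\<close> must
  satisfy \<open>|b \<inter> (V - T)| = \<rho>(V - T)\<close>, since otherwise exchanging an element of \<open>b \<inter> T\<close> for one outside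
  \<open>T\<close> would shorten \<open>p\<close>. Summing \<open>p\<close> over \<open>T\<close> gives \<open>m |T| = \<rho>(V) - \<rho>(V - T)\<close>, so the fractional
  matching \<open>y / m\<close> has value \<open>1 / m \<ge> \<sigma>'\<close>.
\<close>

section \<open>Weak linear programming duality\<close>

lemma sum_incidence_swap:
  fixes f :: "'a \<Rightarrow> 'a set \<Rightarrow> real"
  assumes "finite A" "finite E"
  shows "(\<Sum>v \<in> A. \<Sum>e \<in> {e \<in> E. v \<in> e}. f v e) = (\<Sum>e \<in> E. \<Sum>v \<in> A \<inter> e. f v e)"
proof -
  have "(\<Sum>v \<in> A. \<Sum>e \<in> {e \<in> E. v \<in> e}. f v e) = (\<Sum>e \<in> E. \<Sum>v \<in> {v \<in> A. v \<in> e}. f v e)"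
    by (rule sum.swap_restrict[OF assms])
  then show ?thesis by (simp add: Int_def)
qed

text \<open>Multiplying each \<open>y e\<close> by the cover weight of \<open>e\<close>, which is at
  least 1, can only increase the sum. After the order of summation is swapped, the matching
  constraint bounds the factor of each \<open>x v\<close> by 1.\<close>

lemma fractional_matching_le_cover:
  assumes "finite V" and sub: "\<And>e. e \<in> E \<Longrightarrow> e \<subseteq> V"
    and y: "fractional_matching (V, E) y" and x: "fractional_cover (V, E) x"
  shows "(\<Sum>e \<in> E. y e) \<le> (\<Sum>v \<in> V. x v)"
proof -
  have "E \<subseteq> Pow V" using sub by blast
  then have "finite E" using \<open>finite V\<close> by (meson finite_Pow_iff finite_subset)
  have "(\<Sum>e \<in> E. y e) \<le> (\<Sum>e \<in> E. y e * (\<Sum>v \<in> e. x v))"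
    using x y by (intro sum_mono) (auto simp: fractional_matching_def fractional_cover_def mult_le_cancel_left1)
  also have "\<dots> = (\<Sum>e \<in> E. \<Sum>v \<in> V \<inter> e. x v * y e)"
    using sub by (intro sum.cong) (auto simp: sum_distrib_left mult.commute Int_absorb1)
  also have "\<dots> = (\<Sum>v \<in> V. x v * (\<Sum>e \<in> {e \<in> E. v \<in> e}. y e))"
    by (simp add: sum_incidence_swap[OF \<open>finite V\<close> \<open>finite E\<close>, symmetric] sum_distrib_left)
  also have "\<dots> \<le> (\<Sum>v \<in> V. x v)"
    using x y by (intro sum_mono) (auto simp: fractional_matching_def fractional_cover_def mult_left_le)
  finally show ?thesis .
qed

context matroid
begin

section \<open>Bases, rank and exchange\<close>

lemma finite_bases: "finite \<B>"
  using bases_subset finite_ground by (meson PowI finite_Pow_iff finite_subset subsetI)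

lemma finite_basis: "b \<in> \<B> \<Longrightarrow> finite b"
  using bases_subset finite_ground finite_subset by blast

text \<open>Replacing an element of \<open>b - c\<close> by one of \<open>c - b\<close> keeps the
  size of \<open>b\<close> and shrinks \<open>b - c\<close>. By symmetry all bases are
  equicardinal.\<close>

lemma card_basis_le:
  assumes "b \<in> \<B>" "c \<in> \<B>"
  shows "card b \<le> card c"
  using assms
proof (induction "card (b - c)" arbitrary: b)
  case 0
  then show ?case by (simp add: finite_basis card_mono)
next
  case (Suc n)
  then obtain u where u: "u \<in> b - c" by (metis card.empty ex_in_conv nat.distinct(1))
  with basis_exchange Suc.prems obtain w where w: "w \<in> c - b" and d: "insert w (b - {u}) \<in> \<B>"
    by blast
  have "insert w (b - {u}) - c = (b - c) - {u}" using w by auto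
  then have "n = card (insert w (b - {u}) - c)" using Suc.hyps(2) u by simp
  with Suc.hyps(1) d Suc.prems(2) have "card (insert w (b - {u})) \<le> card c" by blast
  moreover have "card (insert w (b - {u})) = card b"
    using u w finite_basis[OF Suc.prems(1)] card_Suc_Diff1[of b u] by simp
  ultimately show ?case by simp
qed

lemma rank_ge: "b \<in> \<B> \<Longrightarrow> card (S \<inter> b) \<le> matroid_rank \<B> S"
  unfolding matroid_rank_def using finite_bases
  by (intro Max_ge) (auto simp: setcompr_eq_image)

lemma rank_attained: obtains b where "b \<in> \<B>" "card (S \<inter> b) = matroid_rank \<B> S"
proof -
  have "matroid_rank \<B> S \<in> {card (S \<inter> e) | e. e \<in> \<B>}"
    unfolding matroid_rank_def using finite_bases bases_nonempty
    by (intro Max_in) (auto simp: setcompr_eq_image)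
  then show ?thesis using that by auto
qed

lemma rank_ground: "b \<in> \<B> \<Longrightarrow> matroid_rank \<B> V = card b"
  by (metis rank_attained bases_subset card_basis_le inf.absorb2 le_antisym)

lemma card_diff_basis:
  assumes "b \<in> \<B>"
  shows "card (b - S) = matroid_rank \<B> V - card (S \<inter> b)" "card (S \<inter> b) \<le> matroid_rank \<B> V"
  using assms finite_basis[OF assms]
  by (auto simp: rank_ground card_Diff_subset_Int Int_commute intro: card_mono)

text \<open>Plain exchange does not control where the new element lies. It is forced into
  \<open>S\<close> by taking \<open>c\<close>, among the bases with more elements in
  \<open>S\<close> than \<open>b\<close>, with the largest overlap with \<open>b\<close>: an element
  of \<open>c - b\<close> outside \<open>S\<close> could be traded for one of \<open>b\<close>,
  which raises the overlap and loses nothing in \<open>S\<close>.\<close>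

lemma exchange_into:
  assumes b: "b \<in> \<B>" and less: "card (S \<inter> b) < matroid_rank \<B> S"
  obtains u w where "u \<in> b - S" "w \<in> S - b" "insert w (b - {u}) \<in> \<B>"
proof -
  define C where "C = {c \<in> \<B>. card (S \<inter> b) < card (S \<inter> c)}"
  have "finite C" using finite_bases by (simp add: C_def)
  obtain d where "d \<in> \<B>" "card (S \<inter> d) = matroid_rank \<B> S" by (rule rank_attained)
  with less have "C \<noteq> {}" by (auto simp: C_def)
  with \<open>finite C\<close> obtain c where c: "c \<in> C"
    and Max: "Max ((\<lambda>d. card (b \<inter> d)) ` C) = card (b \<inter> c)"
    by (rule obtains_MAX)
  have max: "card (b \<inter> d) \<le> card (b \<inter> c)" if "d \<in> C" for d
    using that \<open>finite C\<close> by (simp flip: Max)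
  have cB: "c \<in> \<B>" using c by (simp add: C_def)
  have sub: "c - b \<subseteq> S"
  proof
    fix u assume u: "u \<in> c - b"
    show "u \<in> S"
    proof (rule ccontr)
      assume "u \<notin> S"
      obtain w where w: "w \<in> b - c" and d: "insert w (c - {u}) \<in> \<B>"
        using basis_exchange[OF cB b u] by blast
      have "S \<inter> c \<subseteq> S \<inter> insert w (c - {u})" using \<open>u \<notin> S\<close> by blast
      then have "card (S \<inter> c) \<le> card (S \<inter> insert w (c - {u}))"
        using finite_basis[OF d] by (simp add: card_mono)
      then have "insert w (c - {u}) \<in> C" using c d by (simp add: C_def)
      moreover have "b \<inter> insert w (c - {u}) = insert w (b \<inter> c)" using u w by auto
      ultimately show False using max[of "insert w (c - {u})"] w finite_basis[OF cB] by simp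
    qed
  qed
  \<comment> \<open>Equal size of bases turns the surplus of \<open>c\<close> inside
    \<open>S\<close> into a deficit outside \<open>S\<close>, so some element of
    \<open>b - S\<close> is missing from \<open>c\<close>.\<close>
  have "card (c - S) < card (b - S)"
    using c card_diff_basis[OF b, of S] card_diff_basis[OF cB, of S]
    unfolding C_def mem_Collect_eq by linarith
  then have "\<not> b - S \<subseteq> c - S"
    using finite_basis[OF cB] by (meson card_mono finite_Diff leD)
  then obtain u where "u \<in> b - S" "u \<in> b - c" by blast
  then show ?thesis using basis_exchange[OF b cB, of u] sub that[of u] by blast
qed

text \<open>A basis has at most \<rho>(S) of its \<rho>(V) elements in \<open>S\<close>, hence at
  least \<rho>(V) - \<rho>(S) outside.\<close>

lemma fractional_cover_complement:
  assumes "S \<subseteq> V" and less: "matroid_rank \<B> S < matroid_rank \<B> V"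
  shows "fractional_cover (V, \<B>)
    (\<lambda>v. if v \<in> S then 0 else 1 / (real (matroid_rank \<B> V) - real (matroid_rank \<B> S)))"
    (is "fractional_cover _ ?x")
proof -
  have "1 \<le> (\<Sum>v \<in> b. ?x v)" if b: "b \<in> \<B>" for b
  proof -
    have "(\<Sum>v \<in> b. ?x v) = (\<Sum>v \<in> b - S. ?x v)"
      using finite_basis[OF b] by (intro sum.mono_neutral_right) auto
    also have "\<dots> = real (card (b - S)) / (real (matroid_rank \<B> V) - real (matroid_rank \<B> S))"
      by simp
    also have "1 \<le> \<dots>"
      using less rank_ge[OF b, of S] card_diff_basis[OF b, of S] by (auto simp: divide_simps)
    finally show ?thesis .
  qed
  then show ?thesis using less by (auto simp: fractional_cover_def)
qed

section \<open>The point of least norm in the base polytope\<close>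

definition marginal :: "('a set \<Rightarrow> real) \<Rightarrow> 'a \<Rightarrow> real" where
  "marginal y v = (\<Sum>b \<in> {b \<in> \<B>. v \<in> b}. y b)"

definition distribution :: "('a set \<Rightarrow> real) \<Rightarrow> bool" where
  "distribution y \<longleftrightarrow> (\<forall>b \<in> \<B>. 0 \<le> y b) \<and> (\<Sum>b \<in> \<B>. y b) = 1"

lemma sum_marginal:
  "finite A \<Longrightarrow> (\<Sum>v \<in> A. marginal y v) = (\<Sum>b \<in> \<B>. real (card (A \<inter> b)) * y b)"
  unfolding marginal_def by (simp add: sum_incidence_swap finite_bases)

text \<open>The norm is minimised over the coefficients rather than over the polytope, since the
  coefficients themselves become the matching.\<close>

lemma ex_least_norm_distribution:
  "\<exists>y. distribution y \<and>
    (\<forall>z. distribution z \<longrightarrow> (\<Sum>v \<in> V. (marginal y v)\<^sup>2) \<le> (\<Sum>v \<in> V. (marginal z v)\<^sup>2))"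
proof -
  \<comment> \<open>A distribution is arbitrary off \<open>\<B>\<close>. Setting it to 0 there gives
    a compact set and changes no marginal.\<close>
  define F where "F = unit_cube \<B> \<inter> {y. (\<Sum>b \<in> \<B>. y b) = 1}"
  have "closed {y :: 'a set \<Rightarrow> real. (\<Sum>b \<in> \<B>. y b) = 1}"
    by (intro closed_Collect_eq continuous_on_sum_coordinates continuous_on_const)
  then have "compact F"
    unfolding F_def by (intro compact_Int_closed compact_unit_cube)
  moreover have restrict: "(\<lambda>b. if b \<in> \<B> then z b else 0) \<in> F" if z: "distribution z" for z
  proof -
    have "z b \<le> 1" if "b \<in> \<B>" for b
      using member_le_sum[of b \<B> z] that z finite_bases by (auto simp: distribution_def)
    then show ?thesis using z by (auto simp: F_def unit_cube_def distribution_def)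
  qed
  moreover obtain b where "b \<in> \<B>" using bases_nonempty by blast
  then have "distribution (\<lambda>c. if c = b then 1 else 0)"
    using finite_bases by (simp add: distribution_def)
  from restrict[OF this] have "F \<noteq> {}" by blast
  moreover have "continuous_on F (\<lambda>y. \<Sum>v \<in> V. (marginal y v)\<^sup>2)"
    unfolding marginal_def
    by (intro continuous_on_sum continuous_on_power
        continuous_on_subset[OF continuous_on_sum_coordinates]) auto
  ultimately obtain y where y: "y \<in> F"
    and min: "\<And>z. z \<in> F \<Longrightarrow> (\<Sum>v \<in> V. (marginal y v)\<^sup>2) \<le> (\<Sum>v \<in> V. (marginal z v)\<^sup>2)"
    using continuous_attains_inf[of F "\<lambda>y. \<Sum>v \<in> V. (marginal y v)\<^sup>2"] by blast
  have "distribution y"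
    using y by (auto simp: F_def unit_cube_def distribution_def) (metis atLeastAtMost_iff)
  moreover have "marginal (\<lambda>b. if b \<in> \<B> then z b else 0) v = marginal z v" for z v
    unfolding marginal_def by (intro sum.cong) auto
  ultimately show ?thesis using min[OF restrict] by auto
qed

text \<open>Moving weight \<open>t\<close> from \<open>b\<close> to the exchanged basis lowers the
  marginal at \<open>u\<close> by \<open>t\<close> and raises it at \<open>w\<close> by
  \<open>t\<close>. If the marginal at \<open>u\<close> exceeds that at \<open>w\<close> by
  \<open>g\<close>, the squared norm changes by 2t(t - g), which is negative for small
  \<open>t\<close>.\<close>

lemma least_norm_exchange:
  assumes y: "distribution y"
    and min: "\<And>z. distribution z \<Longrightarrow> (\<Sum>v \<in> V. (marginal y v)\<^sup>2) \<le> (\<Sum>v \<in> V. (marginal z v)\<^sup>2)"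
    and b: "b \<in> \<B>" "0 < y b" and u: "u \<in> b" and w: "w \<notin> b" and c: "insert w (b - {u}) \<in> \<B>"
  shows "marginal y u \<le> marginal y w"
proof (rule ccontr)
  define c where "c = insert w (b - {u})"
  assume "\<not> marginal y u \<le> marginal y w"
  then have gap: "0 < marginal y u - marginal y w" by simp
  \<comment> \<open>The first bound keeps the weight of \<open>b\<close> nonnegative; the second
    keeps \<open>t\<close> strictly below the gap.\<close>
  define t where "t = min (y b) ((marginal y u - marginal y w) / 2)"
  have t: "0 < t" "t \<le> y b" "2 * t \<le> marginal y u - marginal y w"
    using gap b by (auto simp: t_def min_def)
  have cB: "c \<in> \<B>" and "c \<noteq> b" and "u \<noteq> w" using c w u by (auto simp: c_def)
  define z where "z e = y e + (if e = c then t else 0) - (if e = b then t else 0)" for e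
  have "distribution z"
    using y t b cB finite_bases by (auto simp: distribution_def z_def sum.distrib sum_subtractf)
  have mz: "marginal z v = marginal y v + (if v = w then t else 0) - (if v = u then t else 0)" for v
  proof -
    have "marginal z v = marginal y v + (\<Sum>e \<in> {e \<in> \<B>. v \<in> e}. if e = c then t else 0)
        - (\<Sum>e \<in> {e \<in> \<B>. v \<in> e}. if e = b then t else 0)"
      by (simp add: marginal_def z_def sum.distrib sum_subtractf)
    then show ?thesis
      using b cB finite_bases u w \<open>u \<noteq> w\<close> by (auto simp: c_def)
  qed
  have uw: "u \<in> V" "w \<in> V" using bases_subset b cB u by (auto simp: c_def)
  have "(marginal z v)\<^sup>2 = (marginal y v)\<^sup>2 + (if v = w then 2 * t * marginal y w + t\<^sup>2 else 0)
      + (if v = u then t\<^sup>2 - 2 * t * marginal y u else 0)" for v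
    using \<open>u \<noteq> w\<close> by (auto simp: mz power2_eq_square algebra_simps)
  then have "(\<Sum>v \<in> V. (marginal z v)\<^sup>2)
      = (\<Sum>v \<in> V. (marginal y v)\<^sup>2) + 2 * t * (t - (marginal y u - marginal y w))"
    using uw finite_ground by (simp add: sum.distrib power2_eq_square algebra_simps)
  also have "\<dots> < (\<Sum>v \<in> V. (marginal y v)\<^sup>2)"
    using t gap by (simp add: mult_pos_neg)
  finally show False using min[OF \<open>distribution z\<close>] by simp
qed

lemma ex_tight_fractional_matching:
  assumes pos: "0 < matroid_rank \<B> V"
  shows "\<exists>S y. S \<subseteq> V \<and> matroid_rank \<B> S < matroid_rank \<B> V \<and> fractional_matching (V, \<B>) y \<and>
    (\<Sum>b \<in> \<B>. y b) = real (card (V - S)) / (real (matroid_rank \<B> V) - real (matroid_rank \<B> S))"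
proof -
  obtain y where y: "distribution y"
    and min: "\<And>z. distribution z \<Longrightarrow> (\<Sum>v \<in> V. (marginal y v)\<^sup>2) \<le> (\<Sum>v \<in> V. (marginal z v)\<^sup>2)"
    using ex_least_norm_distribution by blast
  have total: "(\<Sum>v \<in> V. marginal y v) = matroid_rank \<B> V"
  proof -
    have "(\<Sum>v \<in> V. marginal y v) = (\<Sum>b \<in> \<B>. real (card (V \<inter> b)) * y b)"
      by (rule sum_marginal[OF finite_ground])
    also have "\<dots> = (\<Sum>b \<in> \<B>. matroid_rank \<B> V * y b)"
      using bases_subset by (intro sum.cong) (auto simp: rank_ground Int_absorb1)
    finally show ?thesis using y by (simp add: distribution_def flip: sum_distrib_left)
  qed
  then have "V \<noteq> {}" using pos by auto
  define m where "m = Max (marginal y ` V)"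
  have m: "marginal y v \<le> m" if "v \<in> V" for v
    using that finite_ground by (simp add: m_def)
  have "0 < m"
  proof (rule ccontr)
    assume "\<not> 0 < m"
    then have "marginal y v \<le> 0" if "v \<in> V" for v using m[OF that] by simp
    then have "(\<Sum>v \<in> V. marginal y v) \<le> 0" by (rule sum_nonpos)
    then show False using total pos by simp
  qed
  \<comment> \<open>The complement of the set where the maximum is attained.\<close>
  define S where "S = {v \<in> V. marginal y v < m}"
  have "m \<in> marginal y ` V" unfolding m_def using finite_ground \<open>V \<noteq> {}\<close> by (intro Max_in) auto
  then have "V - S \<noteq> {}" by (auto simp: S_def)
  have tight: "card (S \<inter> b) = matroid_rank \<B> S" if b: "b \<in> \<B>" "0 < y b" for b
  proof (rule ccontr)
    assume "card (S \<inter> b) \<noteq> matroid_rank \<B> S"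
    then have "card (S \<inter> b) < matroid_rank \<B> S" using rank_ge[OF b(1), of S] by simp
    then obtain u w where uw: "u \<in> b - S" "w \<in> S - b" "insert w (b - {u}) \<in> \<B>"
      using exchange_into[OF b(1)] by blast
    then have "marginal y u \<le> marginal y w"
      \<comment> \<open>Impossible: the marginal is \<open>m\<close> at \<open>u\<close> and less
        than \<open>m\<close> at \<open>w\<close>.\<close>
      using least_norm_exchange[OF y min b] by blast
    then show False using uw bases_subset[OF b(1)] by (auto simp: S_def)
  qed
  have "marginal y v = m" if "v \<in> V - S" for v
    using that m[of v] by (simp add: S_def)
  then have "m * card (V - S) = (\<Sum>v \<in> V - S. marginal y v)" by simp
  also have "\<dots> = (\<Sum>b \<in> \<B>. (real (matroid_rank \<B> V) - real (matroid_rank \<B> S)) * y b)"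
    unfolding sum_marginal[OF finite_Diff[OF finite_ground]]
  proof (rule sum.cong[OF refl])
    fix b assume b: "b \<in> \<B>"
    have "(V - S) \<inter> b = b - S" using bases_subset[OF b] by blast
    then show "card ((V - S) \<inter> b) * y b = (real (matroid_rank \<B> V) - real (matroid_rank \<B> S)) * y b"
      \<comment> \<open>Tightness is known only on the support of \<open>y\<close>; the other bases
        contribute 0 to both sides.\<close>
      using tight[OF b] y b card_diff_basis[OF b, of S]
      by (cases "y b = 0") (auto simp: distribution_def less_le of_nat_diff)
  qed
  also have "\<dots> = real (matroid_rank \<B> V) - real (matroid_rank \<B> S)"
    using y by (simp add: distribution_def flip: sum_distrib_left)
  finally have m_eq: "m * card (V - S) = real (matroid_rank \<B> V) - real (matroid_rank \<B> S)" .
  moreover have card_pos: "0 < card (V - S)"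
    using \<open>V - S \<noteq> {}\<close> finite_ground by (simp add: card_gt_0_iff)
  \<comment> \<open>The rank deficiency equals a product of two positive numbers.\<close>
  ultimately have "matroid_rank \<B> S < matroid_rank \<B> V"
    using \<open>0 < m\<close> by (metis diff_gt_0_iff_gt mult_pos_pos of_nat_0_less_iff of_nat_less_iff)
  \<comment> \<open>Scaling by \<open>1 / m\<close> brings the largest marginal to exactly
    1.\<close>
  moreover have "fractional_matching (V, \<B>) (\<lambda>b. y b / m)"
    using y m \<open>0 < m\<close>
    by (auto simp: fractional_matching_def distribution_def marginal_def simp flip: sum_divide_distrib)
  moreover have "(\<Sum>b \<in> \<B>. y b / m)
      = real (card (V - S)) / (real (matroid_rank \<B> V) - real (matroid_rank \<B> S))"
    using y \<open>0 < m\<close> card_pos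
    by (simp add: distribution_def flip: m_eq sum_divide_distrib)
  moreover have "S \<subseteq> V" by (auto simp: S_def)
  ultimately show ?thesis
    by (intro exI[of _ S] exI[of _ "\<lambda>b. y b / m"] conjI)
qed

end

theorem theorem4:
  fixes V :: "'a set" and \<B> :: "'a set set"
  assumes "nontrivial_matroid V \<B>"
  shows "fractional_matching_number (basis_hypergraph V \<B>) = fractional_cover_number (basis_hypergraph V \<B>)
       \<and> fractional_cover_number (basis_hypergraph V \<B>) = edge_toughness V \<B>"
proof -
  interpret matroid V \<B> using assms by (simp add: nontrivial_matroid_def)
  have pos: "0 < matroid_rank \<B> V" using assms by (simp add: nontrivial_matroid_def)
  \<comment> \<open>Nonempty edges ensure that both optimal values are attained.\<close>
  have ne: "b \<noteq> {}" if "b \<in> \<B>" for b using pos rank_ground[OF that] by auto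
  define ratio where
    "ratio S = real (card (V - S)) / (real (matroid_rank \<B> V) - real (matroid_rank \<B> S))" for S
  define D where "D = {S. S \<subseteq> V \<and> matroid_rank \<B> S < matroid_rank \<B> V}"
  have toughness: "edge_toughness V \<B> = Min (ratio ` D)"
    unfolding edge_toughness_def ratio_def D_def by (rule arg_cong[of _ _ Min]) auto
  have "finite D" using finite_ground by (simp add: D_def)
  obtain y where y: "fractional_matching (V, \<B>) y"
    "(\<Sum>b \<in> \<B>. y b) = fractional_matching_number (V, \<B>)"
    and y_max: "\<And>z. fractional_matching (V, \<B>) z \<Longrightarrow> (\<Sum>b \<in> \<B>. z b) \<le> (\<Sum>b \<in> \<B>. y b)"
    using fractional_matching_number_attained[OF finite_ground bases_subset ne] by blast
  obtain x where x: "fractional_cover (V, \<B>) x"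
    "(\<Sum>v \<in> V. x v) = fractional_cover_number (V, \<B>)"
    and x_min: "\<And>z. fractional_cover (V, \<B>) z \<Longrightarrow> (\<Sum>v \<in> V. x v) \<le> (\<Sum>v \<in> V. z v)"
    using fractional_cover_number_attained[OF finite_ground bases_subset ne] by blast
  obtain S z where S: "S \<in> D" and z: "fractional_matching (V, \<B>) z" "(\<Sum>b \<in> \<B>. z b) = ratio S"
    using ex_tight_fractional_matching[OF pos] by (auto simp: D_def ratio_def)
  have "(\<Sum>v \<in> V. x v) \<le> ratio T" if T: "T \<in> D" for T
  proof -
    let ?x = "\<lambda>v. if v \<in> T then 0 else 1 / (real (matroid_rank \<B> V) - real (matroid_rank \<B> T))"
    have "(\<Sum>v \<in> V. x v) \<le> (\<Sum>v \<in> V. ?x v)"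
      using x_min fractional_cover_complement[of T] T by (simp add: D_def)
    also have "\<dots> = (\<Sum>v \<in> V - T. ?x v)"
      using finite_ground by (intro sum.mono_neutral_right) auto
    also have "\<dots> = ratio T" by (simp add: ratio_def)
    finally show ?thesis .
  qed
  then have "fractional_cover_number (V, \<B>) \<le> edge_toughness V \<B>"
    unfolding toughness using \<open>finite D\<close> S x(2) by (intro Min.boundedI) auto
  \<comment> \<open>The minimum is at most its entry at the single set \<open>S\<close>, which is
    the value of the matching \<open>z\<close>. With weak duality this closes a cycle of three
    inequalities.\<close>
  moreover have "edge_toughness V \<B> \<le> fractional_matching_number (V, \<B>)"
    unfolding toughness using \<open>finite D\<close> S y_max[OF z(1)] y(2) z(2)
    by (intro Min.coboundedI[THEN order_trans, of _ "ratio S"]) auto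
  moreover have "fractional_matching_number (V, \<B>) \<le> fractional_cover_number (V, \<B>)"
    using fractional_matching_le_cover[OF finite_ground bases_subset y(1) x(1)] x(2) y(2) by simp
  ultimately show ?thesis by (simp add: basis_hypergraph_def)
qed

end
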